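(* For every three integers $n\geq k\geq r\geq 2$ the inequality $$ f(n,k,r) \geq \frac{\binom{n}{r-1}}{\binom{k-2}{r-2}}\cdot \frac{n-k+2}{r(n-r+2)}$$ holds.
   Context: A $k$-partition of a finite set $X$ is a partition $\mathcal{P}=(X_1,\dots,X_k)$ of $X$ into precisely $k$ nonempty classes. An $r$-element set $H\subseteq X$ crosses $\mathcal{P}$ if $H$ intersects exactly $\min(r,k)$ of the classes. A hypergraph (set of subsets of $X$) crosses $\mathcal{P}$ if at least one of its members does. For integers $n\ge k$, $n\ge r$, $f(n,k,r)$ denotes the minimum number of edges of an $r$-uniform hypergraph $\mathcal{H}\subseteq\binom{X}{r}$ on an $n$-element set $X$ that crosses every $k$-partition of $X$. *)

theory Defs
  imports Complex_Main "HOL-Library.Disjoint_Sets"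
begin

definition k_partition :: "'a set \<Rightarrow> nat \<Rightarrow> 'a set set \<Rightarrow> bool" where
  "k_partition X k P \<longleftrightarrow> partition_on X P \<and> card P = k"

(* The uniformity r and the number k of classes are read off as card H and card P. *)
definition edge_crosses :: "'a set \<Rightarrow> 'a set set \<Rightarrow> bool" where
  "edge_crosses H P \<longleftrightarrow> card {C \<in> P. H \<inter> C \<noteq> {}} = min (card H) (card P)"

definition hypergraph_crosses :: "'a set set \<Rightarrow> 'a set set \<Rightarrow> bool" where
  "hypergraph_crosses \<H> P \<longleftrightarrow> (\<exists>H\<in>\<H>. edge_crosses H P)"

definition uniform_hypergraph :: "'a set \<Rightarrow> nat \<Rightarrow> 'a set set \<Rightarrow> bool" where
  "uniform_hypergraph X r \<H> \<longleftrightarrow> \<H> \<subseteq> {H. H \<subseteq> X \<and> card H = r}"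

definition crossing_hypergraph :: "'a set \<Rightarrow> nat \<Rightarrow> nat \<Rightarrow> 'a set set \<Rightarrow> bool" where
  "crossing_hypergraph X k r \<H> \<longleftrightarrow> uniform_hypergraph X r \<H> \<and>
     (\<forall>P. k_partition X k P \<longrightarrow> hypergraph_crosses \<H> P)"

(* The n-element ground set is {..<n}; the value does not depend on this choice.
   The minimum is over a nonempty set when k \<le> n and r \<le> n, see ex_crossing_hypergraph. *)
definition min_crossing :: "nat \<Rightarrow> nat \<Rightarrow> nat \<Rightarrow> nat" where
  "min_crossing n k r = (LEAST m. \<exists>\<H>. crossing_hypergraph {..<n} k r \<H> \<and> card \<H> = m)"

lemma ex_crossing_edge:
  assumes X: "finite X" and P: "k_partition X k P" and r: "r \<le> card X"
  shows "\<exists>H\<subseteq>X. card H = r \<and> edge_crosses H P"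
proof -
  have part: "partition_on X P" and k: "card P = k"
    using P by (auto simp: k_partition_def)
  have finP: "finite P"
    using part X by (rule finite_elements[rotated])
  obtain Q where Q: "Q \<subseteq> P" "card Q = min r k"
    using obtain_subset_with_card_n[of "min r k" P] k by auto
  have finQ: "finite Q" using Q finP finite_subset by blast
  have "\<forall>C\<in>Q. \<exists>x. x \<in> C"
    using part Q unfolding partition_on_def by (metis ex_in_conv subsetD)
  then obtain g where g: "\<And>C. C \<in> Q \<Longrightarrow> g C \<in> C" by metis
  have disj: "C = D" if "C \<in> P" "D \<in> P" "x \<in> C" "x \<in> D" for C D x
    using part that unfolding partition_on_def disjoint_def by blast
  have "g ` Q \<subseteq> X" using g Q part by (auto simp: partition_on_def)
  moreover have "card (g ` Q) \<le> r"
    using card_image_le[OF finQ, of g] Q by simp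
  ultimately obtain H where H: "g ` Q \<subseteq> H" "H \<subseteq> X" "card H = r"
    using exists_subset_between[of "g ` Q" r X] r X by blast
  have finH: "finite H" using H X finite_subset by blast
  let ?M = "{C \<in> P. H \<inter> C \<noteq> {}}"
  have "Q \<subseteq> ?M" using Q g H by blast
  then have ge: "min r k \<le> card ?M" using Q finP card_mono[of ?M Q] by auto
  have "\<forall>C\<in>?M. \<exists>x. x \<in> H \<and> x \<in> C" by blast
  then obtain h where h: "\<And>C. C \<in> ?M \<Longrightarrow> h C \<in> H \<and> h C \<in> C" by metis
  have "inj_on h ?M" by (rule inj_onI) (metis (no_types, lifting) disj h mem_Collect_eq)
  then have "card ?M \<le> card H" using h finH by (intro card_inj_on_le[of h]) auto
  moreover have "card ?M \<le> k" using finP k card_mono[of P ?M] by auto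
  ultimately have "card ?M = min (card H) (card P)" using ge H k by auto
  then show ?thesis using H by (auto simp: edge_crosses_def)
qed

lemma ex_crossing_hypergraph:
  assumes "r \<le> n"
  shows "\<exists>\<H>. crossing_hypergraph {..<n} k r \<H>"
proof -
  have "crossing_hypergraph {..<n} k r {H. H \<subseteq> {..<n} \<and> card H = r}"
    unfolding crossing_hypergraph_def uniform_hypergraph_def hypergraph_crosses_def
    using ex_crossing_edge[of "{..<n}" k _ r] assms by auto
  then show ?thesis by blast
qed

end

theory Submission
  imports Defs "HOL-Analysis.Convex"
begin

text \<open>
  The bound is de Caen's lower bound for the hypergraph Turan problem in disguise. Let
  \<open>S\<close> be a set of \<open>k - 1\<close> points. An edge that crosses the partition of \<open>X\<close> into the singletons
  of \<open>S\<close> and the remainder \<open>X - S\<close> meets \<open>r\<close> classes, at most one of which is \<open>X - S\<close>, so it has at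
  least \<open>r - 1\<close> points in \<open>S\<close>. Hence the \<open>(r - 1)\<close>-subsets of edges (the shadow of the hypergraph)
  are such that every \<open>(k - 1)\<close>-set contains one of them. De Caen's theorem bounds the number of
  members of such a family from below, and a hypergraph with \<open>m\<close> edges has a shadow of at most
  \<open>r * m\<close> sets; the quotient is the claimed bound.

  De Caen's theorem concerns a family \<open>F\<close> of \<open>r\<close>-sets in an \<open>n\<close>-set such that every \<open>k\<close>-set contains
  a member. Call a set independent if it contains no member of \<open>F\<close>, and call a point outside an
  independent set \<open>A\<close> blocked for \<open>A\<close> if adding it to \<open>A\<close> destroys independence. Let \<open>d i\<close> be the
  average number of blocked points over the independent \<open>i\<close>-sets. Three facts give the theorem.
  Every \<open>(r - 1)\<close>-set is independent and each member of \<open>F\<close> accounts for \<open>r\<close> blocked points, so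
  \<open>d (r - 1)\<close> is \<open>r * card F\<close> divided by \<open>n choose (r - 1)\<close>. Double counting and the
  Cauchy-Schwarz inequality show that \<open>(i + 2 - r) * d (i + 1)\<close> is at most \<open>(i + 1) * d i\<close>
  (lemma \<open>blocked_average_step\<close>), so \<open>d i\<close> is at most \<open>(i choose (r - 1)) * d (r - 1)\<close>.
  Finally, since no \<open>k\<close>-set is independent, there is a largest size \<open>m < k\<close> of an independent
  set; at this size every outside point is blocked, so \<open>d m = n - m\<close>.
\<close>

section \<open>Independent sets and blocked points\<close>

definition independent_sets :: "'a set \<Rightarrow> 'a set set \<Rightarrow> nat \<Rightarrow> 'a set set" where
  "independent_sets X F i = {A. A \<subseteq> X \<and> card A = i \<and> (\<forall>e\<in>F. \<not> e \<subseteq> A)}"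

definition blocked :: "'a set \<Rightarrow> 'a set set \<Rightarrow> 'a set \<Rightarrow> 'a set" where
  "blocked X F A = {x \<in> X - A. \<exists>e\<in>F. e \<subseteq> insert x A}"

definition unblocked :: "'a set \<Rightarrow> 'a set set \<Rightarrow> 'a set \<Rightarrow> 'a set" where
  "unblocked X F A = {x \<in> X - A. \<forall>e\<in>F. \<not> e \<subseteq> insert x A}"

lemma finite_independent_sets: "finite X \<Longrightarrow> finite (independent_sets X F i)"
  unfolding independent_sets_def by (rule finite_subset[of _ "Pow X"]) auto

lemma finite_blocked: "finite X \<Longrightarrow> finite (blocked X F A)"
  by (simp add: blocked_def)

lemma finite_unblocked: "finite X \<Longrightarrow> finite (unblocked X F A)"
  by (simp add: unblocked_def)

lemma card_unblocked:
  assumes "finite X" "A \<in> independent_sets X F i"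
  shows "real (card (unblocked X F A)) = real (card X) - real i - real (card (blocked X F A))"
proof -
  have A: "A \<subseteq> X" "card A = i" using assms by (auto simp: independent_sets_def)
  have "card (X - A) = card (blocked X F A \<union> unblocked X F A)"
    by (rule arg_cong[of _ _ card]) (auto simp: blocked_def unblocked_def)
  also have "\<dots> = card (blocked X F A) + card (unblocked X F A)"
    using assms by (intro card_Un_disjoint finite_blocked finite_unblocked)
      (auto simp: blocked_def unblocked_def)
  finally have "card X - i = card (blocked X F A) + card (unblocked X F A)"
    using A assms by (simp add: card_Diff_subset finite_subset)
  moreover have "i \<le> card X" using A assms card_mono by blast
  ultimately show ?thesis by linarith
qed

lemma independent_sets_remove:
  assumes "finite X" "A \<in> independent_sets X F (Suc i)" "x \<in> A"
  shows "A - {x} \<in> independent_sets X F i"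
  using assms by (auto simp: independent_sets_def card_Diff_singleton finite_subset)

text \<open>
  Both sides count the pairs of an independent \<open>(i + 1)\<close>-set \<open>A\<close> and a point \<open>x\<close> of \<open>A\<close>, each with
  weight \<open>g\<close> of the set \<open>C\<close> obtained by removing \<open>x\<close>: on the right, the pair is rebuilt from \<open>C\<close> and
  an unblocked point.
\<close>

lemma sum_independent_sets_Suc:
  fixes g :: "'a set \<Rightarrow> real"
  assumes X: "finite X"
  shows "(\<Sum>A\<in>independent_sets X F (Suc i). \<Sum>x\<in>A. g (A - {x})) =
    (\<Sum>C\<in>independent_sets X F i. real (card (unblocked X F C)) * g C)"
proof -
  have fin: "\<forall>A\<in>independent_sets X F j. finite A" for j
    using X by (auto simp: independent_sets_def finite_subset)
  have remove: "A - {x} \<in> independent_sets X F i \<and> x \<in> unblocked X F (A - {x})"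
    if "A \<in> independent_sets X F (Suc i)" "x \<in> A" for A x
  proof
    show "A - {x} \<in> independent_sets X F i"
      using independent_sets_remove[OF X that] .
    show "x \<in> unblocked X F (A - {x})"
      using that by (auto simp: independent_sets_def unblocked_def insert_absorb)
  qed
  have add: "insert x C \<in> independent_sets X F (Suc i) \<and> x \<notin> C"
    if C: "C \<in> independent_sets X F i" and x: "x \<in> unblocked X F C" for C x
  proof -
    have "finite C" using C fin by blast
    then show ?thesis using C x by (auto simp: independent_sets_def unblocked_def)
  qed
  have "(\<Sum>A\<in>independent_sets X F (Suc i). \<Sum>x\<in>A. g (A - {x})) =
     (\<Sum>(A,x)\<in>(SIGMA A:independent_sets X F (Suc i). A). g (A - {x}))"
    using X fin by (intro sum.Sigma finite_independent_sets) auto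
  also have "\<dots> = (\<Sum>(C,x)\<in>(SIGMA C:independent_sets X F i. unblocked X F C). g C)"
    by (rule sum.reindex_bij_witness[where i = "\<lambda>(C,x). (insert x C, x)"
          and j = "\<lambda>(A,x). (A - {x}, x)"])
       (use remove add in \<open>auto simp: insert_absorb\<close>)
  also have "\<dots> = (\<Sum>C\<in>independent_sets X F i. \<Sum>x\<in>unblocked X F C. g C)"
    using X by (intro sum.Sigma[symmetric] finite_independent_sets) (auto simp: finite_unblocked)
  finally show ?thesis by simp
qed

text \<open>
  If \<open>x\<close> is blocked for \<open>A\<close>, choose a member \<open>e\<close> of \<open>F\<close> with \<open>e \<subseteq> insert x A\<close>. As \<open>A\<close> is independent,
  \<open>e\<close> contains \<open>x\<close> and thus only \<open>s\<close> points of \<open>A\<close>. Removing any other point \<open>y\<close> of \<open>A\<close> leaves \<open>e\<close> in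
  place, so \<open>x\<close> stays blocked for at least \<open>i + 1 - s\<close> of the sets \<open>A - {y}\<close>.
\<close>

lemma sum_card_blocked_remove:
  assumes X: "finite X" and F: "uniform_hypergraph X (Suc s) F"
    and A: "A \<in> independent_sets X F (Suc i)"
  shows "(Suc i - s) * card (blocked X F A) \<le> (\<Sum>y\<in>A. card (blocked X F (A - {y})))"
proof -
  have finA: "finite A" and cardA: "card A = Suc i"
    using A X by (auto simp: independent_sets_def finite_subset)
  have "\<exists>e. e \<in> F \<and> e \<subseteq> insert x A" if "x \<in> blocked X F A" for x
    using that by (auto simp: blocked_def)
  then obtain e where e: "\<And>x. x \<in> blocked X F A \<Longrightarrow> e x \<in> F \<and> e x \<subseteq> insert x A"
    by metis
  have "Suc i - s \<le> card (A - e x)" if x: "x \<in> blocked X F A" for x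
  proof -
    have "x \<in> e x" using e[OF x] A by (auto simp: independent_sets_def)
    moreover have "card (e x) = Suc s"
      using e[OF x] F by (auto simp: uniform_hypergraph_def)
    moreover have "x \<notin> A" using x by (auto simp: blocked_def)
    ultimately have "finite (e x)" "card (e x - {x}) = s" "A \<inter> e x \<subseteq> e x - {x}"
      by (auto intro: card_ge_0_finite)
    then have "card (A \<inter> e x) \<le> s"
      using card_mono[of "e x - {x}" "A \<inter> e x"] by simp
    moreover have "card (A - e x) = card A - card (A \<inter> e x)"
      using finA by (simp add: card_Diff_subset_Int)
    ultimately show ?thesis using cardA by simp
  qed
  then have "(\<Sum>x\<in>blocked X F A. Suc i - s) \<le> (\<Sum>x\<in>blocked X F A. card (A - e x))"
    by (rule sum_mono)
  also have "\<dots> = (\<Sum>x\<in>blocked X F A. card {y \<in> A. y \<notin> e x})"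
    by (simp add: set_diff_eq)
  also have "\<dots> = (\<Sum>y\<in>A. card {x \<in> blocked X F A. y \<notin> e x})"
    using finA finite_blocked[OF X] by (intro sum_multicount_gen) auto
  also have "\<dots> \<le> (\<Sum>y\<in>A. card (blocked X F (A - {y})))"
  proof (intro sum_mono card_mono finite_blocked X subsetI)
    fix y x assume "y \<in> A" "x \<in> {x \<in> blocked X F A. y \<notin> e x}"
    then have x: "x \<in> blocked X F A" "y \<notin> e x" by auto
    then have "e x \<subseteq> insert x (A - {y})" using e by blast
    then show "x \<in> blocked X F (A - {y})" using x e by (auto simp: blocked_def)
  qed
  finally show ?thesis by (simp add: mult.commute)
qed

text \<open>
  Chebyshev's sum inequality for oppositely ordered families: as \<open>a i + b i\<close> is constant, \<open>a\<close> is
  small where \<open>b\<close> is large. After substituting \<open>a i = c - b i\<close> it is the Cauchy-Schwarz inequality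
  for \<open>b\<close>.
\<close>

lemma sum_mult_le_of_const_sum:
  fixes a b :: "'b \<Rightarrow> real"
  assumes I: "finite I" and ab: "\<And>i. i \<in> I \<Longrightarrow> a i + b i = c"
  shows "real (card I) * (\<Sum>i\<in>I. a i * b i) \<le> sum a I * sum b I"
proof -
  have a: "a i = c - b i" if "i \<in> I" for i using ab[OF that] by simp
  have *: "sum a I = real (card I) * c - sum b I"
    using a by (simp add: sum_subtractf)
  have "(\<Sum>i\<in>I. a i * b i) = (\<Sum>i\<in>I. c * b i - (b i)\<^sup>2)"
    by (intro sum.cong) (simp_all add: a algebra_simps power2_eq_square)
  then have **: "(\<Sum>i\<in>I. a i * b i) = c * sum b I - (\<Sum>i\<in>I. (b i)\<^sup>2)"
    by (simp add: sum_subtractf sum_distrib_left)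
  have "(sum b I)\<^sup>2 \<le> real (card I) * (\<Sum>i\<in>I. (b i)\<^sup>2)"
    using sum_squared_le_sum_of_squares[of b I] I by (simp add: mult.commute)
  then show ?thesis
    unfolding * ** by (simp add: algebra_simps power2_eq_square)
qed

section \<open>De Caen's bound\<close>

text \<open>
  In terms of the averages \<open>d i = b i / N i\<close> this reads \<open>(i + 1 - s) * d (i + 1) \<le> (i + 1) * d i\<close>; the
  form without division stays meaningful when there are no independent \<open>i\<close>-sets. The sum of
  \<open>card (blocked X F (A - {y}))\<close> over all independent \<open>(i + 1)\<close>-sets \<open>A\<close> and \<open>y \<in> A\<close> is at least
  \<open>(i + 1 - s) * b (i + 1)\<close>. Grouped by \<open>C = A - {y}\<close>, the same sum weights the number of blocked
  points of \<open>C\<close> by the number of unblocked ones. These two numbers add up to \<open>card X - i\<close>, so they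
  are negatively correlated and the sum is at most the product of their averages times \<open>N i\<close>.
\<close>

lemma blocked_average_step:
  fixes X :: "'a set" and F :: "'a set set" and b N :: "nat \<Rightarrow> real"
  defines "b \<equiv> \<lambda>i. \<Sum>A\<in>independent_sets X F i. real (card (blocked X F A))"
    and "N \<equiv> \<lambda>i. real (card (independent_sets X F i))"
  assumes X: "finite X" and F: "uniform_hypergraph X (Suc s) F"
  shows "N i * (real (Suc i - s) * b (Suc i)) \<le> real (Suc i) * N (Suc i) * b i"
proof -
  let ?I = "independent_sets X F"
  let ?a = "\<lambda>A. real (card (unblocked X F A))" and ?b = "\<lambda>A. real (card (blocked X F A))"
  have "real (Suc i - s) * ?b A \<le> (\<Sum>y\<in>A. ?b (A - {y}))" if "A \<in> ?I (Suc i)" for A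
    using sum_card_blocked_remove[OF X F that]
    by (metis of_nat_mono of_nat_mult of_nat_sum)
  then have "real (Suc i - s) * b (Suc i) \<le> (\<Sum>A\<in>?I (Suc i). \<Sum>y\<in>A. ?b (A - {y}))"
    unfolding b_def sum_distrib_left by (rule sum_mono)
  also have "\<dots> = (\<Sum>C\<in>?I i. ?a C * ?b C)"
    by (rule sum_independent_sets_Suc[OF X])
  finally have "N i * (real (Suc i - s) * b (Suc i)) \<le> N i * (\<Sum>C\<in>?I i. ?a C * ?b C)"
    by (intro mult_left_mono) (auto simp: N_def)
  also have "\<dots> \<le> (\<Sum>C\<in>?I i. ?a C) * b i"
    unfolding b_def N_def
    by (intro sum_mult_le_of_const_sum[where c = "real (card X) - real i"])
      (auto simp: finite_independent_sets X card_unblocked)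
  also have "(\<Sum>C\<in>?I i. ?a C) = (\<Sum>A\<in>?I (Suc i). real (card A))"
    using sum_independent_sets_Suc[OF X, where F = F and i = i and g = "\<lambda>_. 1"] by simp
  also have "\<dots> = real (Suc i) * N (Suc i)"
    by (simp add: N_def independent_sets_def)
  finally show ?thesis .
qed

text \<open>
  A point \<open>x\<close> is blocked for an \<open>s\<close>-set \<open>A\<close> exactly if \<open>insert x A\<close> is itself a member of \<open>F\<close>, so the
  pairs \<open>(A, x)\<close> correspond to the members of \<open>F\<close> with a distinguished point.
\<close>

lemma sum_card_blocked_base:
  assumes X: "finite X" and F: "uniform_hypergraph X (Suc s) F"
  shows "independent_sets X F s = {A. A \<subseteq> X \<and> card A = s}"
    and "(\<Sum>A\<in>independent_sets X F s. card (blocked X F A)) = Suc s * card F"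
proof -
  have fin: "finite e" "card e = Suc s" "e \<subseteq> X" if "e \<in> F" for e
    using that F X by (auto simp: uniform_hypergraph_def finite_subset)
  have finF: "finite F" using X fin by (intro finite_subset[of F "Pow X"]) auto
  have "\<not> e \<subseteq> A" if "e \<in> F" "A \<subseteq> X" "card A = s" for e A
    using card_mono[of A e] finite_subset[OF that(2) X] fin(2)[OF that(1)] that(3) by auto
  then show I: "independent_sets X F s = {A. A \<subseteq> X \<and> card A = s}"
    unfolding independent_sets_def by blast
  have "e = insert x A" if "e \<in> F" "e \<subseteq> insert x A" "card A = s" "A \<subseteq> X" for e x A
  proof (rule card_seteq)
    have "finite A" using that(4) X by (rule finite_subset)
    then show "finite (insert x A)" by simp
    have "card (insert x A) \<le> Suc s" using \<open>finite A\<close> that(3) by (simp add: card_insert_if)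
    then show "card (insert x A) \<le> card e" using fin(2)[OF that(1)] by simp
    show "e \<subseteq> insert x A" by fact
  qed
  then have "(\<exists>e\<in>F. e \<subseteq> insert x A) \<longleftrightarrow> insert x A \<in> F" if "card A = s" "A \<subseteq> X" for x A
    using that by (metis order_refl)
  then have bl: "blocked X F A = {x \<in> X - A. insert x A \<in> F}"
    if "card A = s" "A \<subseteq> X" for A
    using that by (simp add: blocked_def)
  have "(\<Sum>A\<in>independent_sets X F s. card (blocked X F A)) =
      card (SIGMA A:independent_sets X F s. blocked X F A)"
    by (rule card_SigmaI[symmetric]) (simp_all add: X finite_independent_sets finite_blocked)
  also have "\<dots> = card (SIGMA e:F. e)"
  proof (rule bij_betw_same_card)
    let ?f = "\<lambda>(A, x). (insert x A, x)" and ?g = "\<lambda>(e, x). (e - {x}, x)"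
    let ?S = "SIGMA A:independent_sets X F s. blocked X F A" and ?T = "SIGMA e:F. e"
    have S: "(A, x) \<in> ?S \<longleftrightarrow> A \<subseteq> X \<and> card A = s \<and> x \<in> X - A \<and> insert x A \<in> F" for A x
      by (auto simp: I bl)
    show "bij_betw ?f ?S ?T"
    proof (rule bij_betw_byWitness[where f' = ?g])
      show "\<forall>p\<in>?S. ?g (?f p) = p" by (auto simp: blocked_def)
      show "\<forall>p\<in>?T. ?f (?g p) = p" by (auto simp: insert_absorb)
      show "?f ` ?S \<subseteq> ?T" using S by auto
      show "?g ` ?T \<subseteq> ?S"
      proof (rule image_subsetI)
        fix p assume "p \<in> ?T"
        then obtain e x where e: "p = (e, x)" "e \<in> F" "x \<in> e" by blast
        then have "card (e - {x}) = s" "insert x (e - {x}) = e" "e \<subseteq> X"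
          using fin by (auto simp: card_Diff_singleton)
        then have "(e - {x}, x) \<in> ?S" unfolding S using e by auto
        then show "?g p \<in> ?S" using e by simp
      qed
    qed
  qed
  also have "\<dots> = (\<Sum>e\<in>F. card e)"
    using finF fin(1) by (intro card_SigmaI) auto
  also have "\<dots> = Suc s * card F"
    by (simp add: fin(2))
  finally show "(\<Sum>A\<in>independent_sets X F s. card (blocked X F A)) = Suc s * card F" .
qed

text \<open>
  Iterating the previous inequality from \<open>i = s\<close>, the factors \<open>(i + 1) / (i + 1 - s)\<close> multiply up to
  the binomial coefficient. A size without independent sets makes both sides vanish from there on,
  because subsets of independent sets are independent.
\<close>

lemma blocked_average_bound:
  assumes X: "finite X" and F: "uniform_hypergraph X (Suc s) F" and i: "s \<le> i"
  shows "(\<Sum>A\<in>independent_sets X F i. real (card (blocked X F A))) * real (card X choose s)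
    \<le> real (Suc s * card F * (i choose s)) * real (card (independent_sets X F i))"
  using i
proof (induction i rule: dec_induct)
  case base
  show ?case
    using sum_card_blocked_base[OF X F] n_subsets[OF X, of s]
    by (simp flip: of_nat_sum)
next
  case (step i)
  let ?I = "independent_sets X F"
  let ?b = "\<lambda>i. \<Sum>A\<in>?I i. real (card (blocked X F A))" and ?N = "\<lambda>i. real (card (?I i))"
  let ?M = "real (card X choose s)" and ?t = "real (Suc s * card F)"
  show ?case
  proof (cases "?I i = {}")
    case True
    have "?I (Suc i) = {}"
    proof (rule equals0I)
      fix A assume A: "A \<in> ?I (Suc i)"
      then obtain x where "x \<in> A" by (fastforce simp: independent_sets_def)
      then show False using independent_sets_remove[OF X A] True by blast
    qed
    then show ?thesis by simp
  next
    case False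
    then have N: "?N i > 0" using finite_independent_sets[OF X] by (auto simp: card_gt_0_iff)
    have absorb: "real (Suc i) * real (i choose s) = real (Suc i - s) * real (Suc i choose s)"
      using binomial_absorb_comp[of "Suc i" s] by (metis diff_Suc_1 of_nat_mult)
    have "?N i * real (Suc i - s) * (?b (Suc i) * ?M) = ?N i * (real (Suc i - s) * ?b (Suc i)) * ?M"
      by (simp only: mult_ac)
    also have "\<dots> \<le> real (Suc i) * ?N (Suc i) * ?b i * ?M"
      by (intro mult_right_mono blocked_average_step[OF X F]) simp
    also have "\<dots> = real (Suc i) * ?N (Suc i) * (?b i * ?M)"
      by (simp only: mult_ac)
    also have "\<dots> \<le> real (Suc i) * ?N (Suc i) * (real (Suc s * card F * (i choose s)) * ?N i)"
      by (intro mult_left_mono step.IH) simp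
    also have "\<dots> = ?N i * ?t * ?N (Suc i) * (real (Suc i) * real (i choose s))"
      by (simp only: mult_ac of_nat_mult)
    also have "\<dots> = ?N i * real (Suc i - s) * (real (Suc s * card F * (Suc i choose s)) * ?N (Suc i))"
      unfolding absorb by (simp only: mult_ac of_nat_mult)
    finally show ?thesis
      by (rule mult_left_le_imp_le) (use N step.hyps in simp)
  qed
qed

text \<open>
  De Caen's theorem, freed of divisions. The averaged bound is applied at the last size \<open>m\<close> for which
  independent sets exist, where all \<open>card X - m\<close> outside points are blocked. As \<open>m \<le> k - 1\<close>,
  replacing \<open>m\<close> by \<open>k - 1\<close> only weakens the resulting inequality.
\<close>

theorem de_Caen_bound:
  assumes X: "finite X" and F: "uniform_hypergraph X r F"
    and rk: "1 \<le> r" "r \<le> k" "k \<le> card X"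
    and turan: "\<And>S. S \<subseteq> X \<Longrightarrow> card S = k \<Longrightarrow> \<exists>e\<in>F. e \<subseteq> S"
  shows "(card X choose r) * (card X - k + 1) \<le> card F * ((k - 1) choose (r - 1)) * (card X - r + 1)"
proof -
  obtain s where r: "r = Suc s" using rk by (cases r) auto
  let ?n = "card X"
  let ?I = "independent_sets X F"
  have F': "uniform_hypergraph X (Suc s) F" using F r by simp
  have "\<exists>m. s \<le> m \<and> m < k \<and> ?I m \<noteq> {} \<and> ?I (Suc m) = {}"
  proof (rule ccontr)
    assume none: "\<not> ?thesis"
    have "?I m \<noteq> {}" if "s \<le> m" "m \<le> k" for m
      using that
    proof (induction m rule: dec_induct)
      case base
      have "s \<le> ?n" using rk r by simp
      then obtain A where "A \<subseteq> X" "card A = s"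
        by (rule obtain_subset_with_card_n)
      then show ?case
        by (auto simp: sum_card_blocked_base(1)[OF X F'])
    next
      case (step m)
      then have "s \<le> m" "m < k" "?I m \<noteq> {}" by auto
      then show ?case using none by blast
    qed
    then have "?I k \<noteq> {}" using rk r by simp
    then show False using turan by (auto simp: independent_sets_def)
  qed
  then obtain m where m: "s \<le> m" "m < k" "?I m \<noteq> {}" "?I (Suc m) = {}" by blast
  have "card (blocked X F A) = ?n - m" if A: "A \<in> ?I m" for A
  proof -
    have finA: "finite A" "A \<subseteq> X" "card A = m"
      using A X by (auto simp: independent_sets_def finite_subset)
    have "insert x A \<notin> ?I (Suc m)" for x using m by simp
    then have "blocked X F A = X - A"
      using finA by (auto simp: blocked_def independent_sets_def card_insert_if)
    then show ?thesis using finA by (simp add: card_Diff_subset)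
  qed
  then have "(\<Sum>A\<in>?I m. real (card (blocked X F A))) = real (card (?I m)) * real (?n - m)"
    by simp
  then have "real (card (?I m)) * (real (?n - m) * real (?n choose s))
      \<le> real (card (?I m)) * real (Suc s * card F * (m choose s))"
    using blocked_average_bound[OF X F' m(1)] by (simp add: mult_ac)
  moreover have "real (card (?I m)) > 0"
    using m finite_independent_sets[OF X] by (auto simp: card_gt_0_iff)
  ultimately have "real (?n - m) * real (?n choose s) \<le> real (Suc s * card F * (m choose s))"
    by (rule mult_left_le_imp_le)
  then have main: "(?n - m) * (?n choose s) \<le> Suc s * card F * (m choose s)"
    by (metis of_nat_le_iff of_nat_mult)
  have absorb: "Suc s * (?n choose r) = (?n - s) * (?n choose s)"
    by (simp only: r binomial_absorption binomial_absorb_comp)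
  have "Suc s * ((?n choose r) * (?n - k + 1)) = Suc s * (?n choose r) * (?n - k + 1)"
    by (simp only: mult.assoc)
  also have "\<dots> = (?n - s) * ((?n - k + 1) * (?n choose s))"
    unfolding absorb by (simp only: mult_ac)
  also have "\<dots> \<le> (?n - s) * ((?n - m) * (?n choose s))"
    using m rk by (intro mult_left_mono mult_right_mono) auto
  also have "\<dots> \<le> (?n - s) * (Suc s * card F * (m choose s))"
    by (intro mult_left_mono main) simp
  also have "\<dots> \<le> (?n - s) * (Suc s * card F * ((k - 1) choose s))"
    using m by (intro mult_left_mono binomial_right_mono) auto
  also have "\<dots> = Suc s * (card F * ((k - 1) choose (r - 1)) * (?n - r + 1))"
  proof -
    have "?n - s = ?n - r + 1" "r - 1 = s" using rk r by auto
    then show ?thesis by (simp only: mult_ac)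
  qed
  finally show ?thesis by (simp only: Suc_mult_le_cancel1)
qed

section \<open>Crossing hypergraphs and their shadows\<close>

definition shadow :: "'a set set \<Rightarrow> nat \<Rightarrow> 'a set set" where
  "shadow \<H> s = {T. card T = s \<and> (\<exists>H\<in>\<H>. T \<subseteq> H)}"

lemma card_shadow_le:
  assumes X: "finite X" and H: "uniform_hypergraph X (Suc s) \<H>"
  shows "card (shadow \<H> s) \<le> Suc s * card \<H>"
proof -
  have fin: "finite H" "card H = Suc s" "H \<subseteq> X" if "H \<in> \<H>" for H
    using that H X by (auto simp: uniform_hypergraph_def finite_subset)
  have finH: "finite \<H>" using X fin by (intro finite_subset[of \<H> "Pow X"]) auto
  have "shadow \<H> s = (\<Union>H\<in>\<H>. {T. T \<subseteq> H \<and> card T = s})"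
    by (auto simp: shadow_def)
  also have "card \<dots> \<le> (\<Sum>H\<in>\<H>. card {T. T \<subseteq> H \<and> card T = s})"
    by (rule card_UN_le[OF finH])
  also have "\<dots> = (\<Sum>H\<in>\<H>. Suc s)"
    using fin by (intro sum.cong) (auto simp: n_subsets)
  finally show ?thesis by (simp add: algebra_simps)
qed

lemma k_partition_singletons:
  assumes "finite X" "S \<subset> X"
  shows "k_partition X (Suc (card S)) (insert (X - S) ((\<lambda>x. {x}) ` S))"
proof -
  have "X - S \<notin> (\<lambda>x. {x}) ` S" by auto
  moreover have "finite S" using assms finite_subset by blast
  ultimately have "card (insert (X - S) ((\<lambda>x. {x}) ` S)) = Suc (card S)"
    by (simp add: card_image)
  moreover have "partition_on X (insert (X - S) ((\<lambda>x. {x}) ` S))"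
    using assms by (intro partition_onI) (auto simp: disjnt_def)
  ultimately show ?thesis by (simp add: k_partition_def)
qed

text \<open>
  The partition used here is the one into the \<open>k - 1\<close> singletons of \<open>S\<close> and the set \<open>X - S\<close>, which
  is nonempty as \<open>k \<le> card X\<close>. Only the class \<open>X - S\<close> can be met outside \<open>S\<close>, so an edge of size
  \<open>s + 1\<close> that meets \<open>s + 1\<close> classes has at least \<open>s\<close> points in \<open>S\<close>.
\<close>

lemma shadow_hits_subset:
  assumes X: "finite X" and cross: "crossing_hypergraph X k (Suc s) \<H>"
    and k: "Suc s \<le> k" "k \<le> card X" and S: "S \<subseteq> X" "card S = k - 1"
  shows "\<exists>T\<in>shadow \<H> s. T \<subseteq> S"
proof -
  let ?P = "insert (X - S) ((\<lambda>x. {x}) ` S)"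
  have "S \<subset> X" "Suc (card S) = k" using S k by auto
  then have P: "k_partition X k ?P" using k_partition_singletons[OF X] by blast
  then obtain H where H: "H \<in> \<H>" "edge_crosses H ?P"
    using cross unfolding crossing_hypergraph_def hypergraph_crosses_def by blast
  have cH: "card H = Suc s" and finS: "finite S"
    using H cross X S by (auto simp: crossing_hypergraph_def uniform_hypergraph_def finite_subset)
  have "Suc s = card {C \<in> ?P. H \<inter> C \<noteq> {}}"
    using H P cH k by (simp add: edge_crosses_def k_partition_def)
  also have "\<dots> \<le> card (insert (X - S) ((\<lambda>x. {x}) ` (H \<inter> S)))"
    using finS by (intro card_mono) auto
  also have "\<dots> \<le> Suc (card ((\<lambda>x. {x}) ` (H \<inter> S)))"
    using finS by (simp add: card_insert_if)
  also have "\<dots> = Suc (card (H \<inter> S))" by (simp add: card_image)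
  finally have "s \<le> card (H \<inter> S)" by simp
  then obtain T where "T \<subseteq> H \<inter> S" "card T = s"
    by (rule obtain_subset_with_card_n)
  then show ?thesis using H by (auto simp: shadow_def)
qed

text \<open>
  De Caen's bound for the shadow, with \<open>r - 1\<close> and \<open>k - 1\<close> in place of \<open>r\<close> and \<open>k\<close>; the factor \<open>r\<close> on
  the right is the number of shadow sets below an edge.
\<close>

lemma crossing_hypergraph_card_bound:
  assumes X: "finite X" and cross: "crossing_hypergraph X k r \<H>"
    and k: "2 \<le> r" "r \<le> k" "k \<le> card X"
  shows "(card X choose (r - 1)) * (card X - k + 2)
    \<le> card \<H> * (((k - 2) choose (r - 2)) * (r * (card X - r + 2)))"
proof -
  obtain s where r: "r = Suc s" "1 \<le> s" using k by (cases r) auto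
  have unif: "uniform_hypergraph X (Suc s) \<H>"
    using cross r by (simp add: crossing_hypergraph_def)
  have "uniform_hypergraph X s (shadow \<H> s)"
    using unif by (auto simp: uniform_hypergraph_def shadow_def)
  then have "(card X choose s) * (card X - (k - 1) + 1)
      \<le> card (shadow \<H> s) * ((k - 1 - 1) choose (s - 1)) * (card X - s + 1)"
    using cross k r by (intro de_Caen_bound X shadow_hits_subset[OF X]) auto
  also have "\<dots> \<le> Suc s * card \<H> * ((k - 1 - 1) choose (s - 1)) * (card X - s + 1)"
    by (intro mult_right_mono card_shadow_le[OF X unif]) auto
  finally have *: "(card X choose s) * (card X - (k - 1) + 1)
      \<le> Suc s * card \<H> * ((k - 1 - 1) choose (s - 1)) * (card X - s + 1)" .
  have eqs: "card X - (k - 1) + 1 = card X - k + 2" "k - 1 - 1 = k - 2" "s - 1 = r - 2"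
    "card X - s + 1 = card X - r + 2" "Suc s = r" "s = r - 1"
    using k r by auto
  show ?thesis using *[unfolded eqs(1-5)] unfolding eqs(6) by (simp only: mult_ac)
qed

theorem proposition13:
  fixes n k r :: nat
  assumes "n \<ge> k" and "k \<ge> r" and "r \<ge> 2"
  shows "real (min_crossing n k r) \<ge>
    (real (n choose (r - 1)) / real ((k - 2) choose (r - 2))) *
    ((real n - real k + 2) / (real r * (real n - real r + 2)))"
proof -
  have "\<exists>\<H>. crossing_hypergraph {..<n} k r \<H> \<and> card \<H> = min_crossing n k r"
    unfolding min_crossing_def
    by (rule LeastI_ex) (use ex_crossing_hypergraph[of r n k] assms in auto)
  then obtain \<H> where cross: "crossing_hypergraph {..<n} k r \<H>"
    and card: "card \<H> = min_crossing n k r" by blast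
  have "(n choose (r - 1)) * (n - k + 2)
      \<le> min_crossing n k r * (((k - 2) choose (r - 2)) * (r * (n - r + 2)))"
    using crossing_hypergraph_card_bound[OF _ cross] assms card by simp
  then have "real (n choose (r - 1)) * real (n - k + 2)
      \<le> real (min_crossing n k r) * (real ((k - 2) choose (r - 2)) * (real r * real (n - r + 2)))"
    by (metis of_nat_mono of_nat_mult)
  moreover have "real ((k - 2) choose (r - 2)) * (real r * real (n - r + 2)) > 0"
    using assms by simp
  ultimately have "real (n choose (r - 1)) * real (n - k + 2) /
      (real ((k - 2) choose (r - 2)) * (real r * real (n - r + 2))) \<le> real (min_crossing n k r)"
    by (simp add: pos_divide_le_eq)
  moreover have "real (n - k + 2) = real n - real k + 2" "real (n - r + 2) = real n - real r + 2"
    using assms by auto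
  ultimately show ?thesis by (simp only: times_divide_times_eq)
qed

end
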